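(* Let $S$ be an inverse semigroup and $B$ a $C^*$-algebra. Let $\{\mathcal{D}_s\}_{s\in S}$ be a family of closed two-sided ideals of $B$ whose linear span is dense in $B$, $\{\beta_s\}_{s\in S}$ a family of $*$-isomorphisms $\beta_s:\mathcal{D}_{s^*}\to\mathcal{D}_s$, and $\{\omega(s,t)\}_{s,t\in S}$ a family of unitary multipliers $\omega(s,t)\in\mathcal{U}\mathcal{M}(\mathcal{D}_{st})$, such that for all $r,s,t\in S$: (i) $\beta_r\circ\beta_s=\mathrm{Ad}_{\omega(r,s)}\circ\beta_{rs}$; (ii) $\beta_r(x\omega(s,t))\omega(r,st)=\beta_r(x)\omega(r,s)\omega(rs,t)$ whenever $x\in\mathcal{D}_{r^*}\cap\mathcal{D}_{st}$. Assume in addition that $$\omega(s,e)=1_{se}\quad\text{and}\quad \omega(e,s)=1_{es}\quad\text{for all } s\in S,\ e\in E(S).$$ Then $\big(\{\mathcal{D}_s\}_{s\in S},\{\beta_s\}_{s\in S},\{\omega(s,t)\}_{s,t\in S}\big)$ is a twisted action of $S$ on $B$.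
   Context: $E(S)$ is the set of idempotents of $S$, $s^*$ the inverse of $s$; $1_s$ is the unit of the multiplier algebra $\mathcal{M}(\mathcal{D}_s)$; $\mathrm{Ad}_w(x)=wxw^*$; equalities of compositions of partially defined maps include equality of natural domains. A twisted action of $S$ on $B$ is a triple $\big(\{\mathcal{D}_s\},\{\beta_s\},\{\omega(s,t)\}\big)$ of closed two-sided ideals $\mathcal{D}_s$ of $B$ whose linear span is dense in $B$, $*$-isomorphisms $\beta_s:\mathcal{D}_{s^*}\to\mathcal{D}_s$ and unitary multipliers $\omega(s,t)\in\mathcal{U}\mathcal{M}(\mathcal{D}_{st})$ such that for all $r,s,t\in S$, $e,f\in E(S)$: (i) $\beta_r\circ\beta_s=\mathrm{Ad}_{\omega(r,s)}\circ\beta_{rs}$; (ii) $\beta_r(x\omega(s,t))\omega(r,st)=\beta_r(x)\omega(r,s)\omega(rs,t)$ for $x\in\mathcal{D}_{r^*}\cap\mathcal{D}_{st}$; (iii) $\omega(e,f)=1_{ef}$ and $\omega(r,r^*r)=\omega(rr^*,r)=1_r$; (iv) $\omega(s^*,e)\omega(s^*e,s)x=\omega(s^*,s)x$ for $x\in\mathcal{D}_{s^*es}$. *)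

theory Defs
  imports "HOL-Analysis.Analysis"
begin

class inverse_semigroup = semigroup_mult +
  assumes ex1_inverse: "\<exists>!t. s * t * s = s \<and> t * s * t = t"

definition sinv :: "'s::inverse_semigroup \<Rightarrow> 's"
  where "sinv s = (THE t. s * t * s = s \<and> t * s * t = t)"

definition idempotents :: "'s::inverse_semigroup set"
  where "idempotents = {e. e * e = e}"

text \<open>The norm, the real scalar multiplication and completeness come from the superclasses
  \<^class>\<open>real_normed_algebra\<close> and \<^class>\<open>banach\<close>; the algebra is not assumed to be unital.\<close>

class cstar_algebra = real_normed_algebra + banach +
  fixes scaleC :: "complex \<Rightarrow> 'a \<Rightarrow> 'a"  (infixr \<open>*\<^sub>C\<close> 75)
    and adj :: "'a \<Rightarrow> 'a"
  assumes scaleC_add_right: "c *\<^sub>C (x + y) = c *\<^sub>C x + c *\<^sub>C y"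
    and scaleC_add_left: "(c + d) *\<^sub>C x = c *\<^sub>C x + d *\<^sub>C x"
    and scaleC_scaleC: "c *\<^sub>C (d *\<^sub>C x) = (c * d) *\<^sub>C x"
    and scaleC_one: "1 *\<^sub>C x = x"
    and scaleR_scaleC: "r *\<^sub>R x = complex_of_real r *\<^sub>C x"
    and norm_scaleC: "norm (c *\<^sub>C x) = cmod c * norm x"
    and mult_scaleC_left: "(c *\<^sub>C x) * y = c *\<^sub>C (x * y)"
    and mult_scaleC_right: "x * (c *\<^sub>C y) = c *\<^sub>C (x * y)"
    and adj_adj: "adj (adj x) = x"
    and adj_add: "adj (x + y) = adj x + adj y"
    and adj_scaleC: "adj (c *\<^sub>C x) = cnj c *\<^sub>C adj x"
    and adj_mult: "adj (x * y) = adj y * adj x"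
    and cstar_identity: "norm (adj x * x) = (norm x)\<^sup>2"

global_interpretation complex_vector:
  vector_space "scaleC :: complex \<Rightarrow> 'a \<Rightarrow> 'a::cstar_algebra"
  by standard (simp_all add: scaleC_add_right scaleC_add_left scaleC_scaleC scaleC_one)

definition closed_ideal :: "'a::cstar_algebra set \<Rightarrow> bool"
  where "closed_ideal I \<longleftrightarrow> complex_vector.subspace I \<and> closed I \<and>
    (\<forall>x\<in>I. \<forall>b. b * x \<in> I \<and> x * b \<in> I)"

definition star_isomorphism_on :: "'a::cstar_algebra set \<Rightarrow> 'a set \<Rightarrow> ('a \<Rightarrow> 'a) \<Rightarrow> bool"
  where "star_isomorphism_on I J f \<longleftrightarrow> bij_betw f I J \<and>
    (\<forall>x\<in>I. \<forall>y\<in>I. f (x + y) = f x + f y \<and> f (x * y) = f x * f y) \<and>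
    (\<forall>x\<in>I. f (adj x) = adj (f x) \<and> (\<forall>c. f (c *\<^sub>C x) = c *\<^sub>C f x))"

text \<open>Multipliers of an ideal \<open>I\<close> are double centralizers \<open>(L, R)\<close> of \<open>I\<close>, where
  \<open>L x = w x\<close> and \<open>R x = x w\<close> for the multiplier \<open>w\<close>.  Both maps are extended by zero off \<open>I\<close>,
  so that multipliers of \<open>I\<close> are equal iff they are equal as pairs, and so that the algebraic
  operations below need not mention \<open>I\<close>.\<close>

type_synonym 'a multiplier = "('a \<Rightarrow> 'a) \<times> ('a \<Rightarrow> 'a)"

definition lmult :: "'a multiplier \<Rightarrow> 'a \<Rightarrow> 'a"  (infixr \<open>\<rhd>\<close> 72)
  where "w \<rhd> x = fst w x"

definition rmult :: "'a \<Rightarrow> 'a multiplier \<Rightarrow> 'a"  (infixl \<open>\<lhd>\<close> 73)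
  where "x \<lhd> w = snd w x"

definition bounded_clinear_on :: "'a::cstar_algebra set \<Rightarrow> ('a \<Rightarrow> 'a) \<Rightarrow> bool"
  where "bounded_clinear_on I f \<longleftrightarrow>
    (\<forall>x\<in>I. \<forall>y\<in>I. f (x + y) = f x + f y) \<and>
    (\<forall>x\<in>I. \<forall>c. f (c *\<^sub>C x) = c *\<^sub>C f x) \<and>
    (\<exists>K. \<forall>x\<in>I. norm (f x) \<le> K * norm x)"

definition multipliers :: "'a::cstar_algebra set \<Rightarrow> 'a multiplier set"
  where "multipliers I = {w.
    (\<forall>x\<in>I. w \<rhd> x \<in> I \<and> x \<lhd> w \<in> I) \<and>
    (\<forall>x. x \<notin> I \<longrightarrow> w \<rhd> x = 0 \<and> x \<lhd> w = 0) \<and>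
    bounded_clinear_on I (\<lambda>x. w \<rhd> x) \<and> bounded_clinear_on I (\<lambda>x. x \<lhd> w) \<and>
    (\<forall>x\<in>I. \<forall>y\<in>I.
      w \<rhd> (x * y) = (w \<rhd> x) * y \<and> (x * y) \<lhd> w = x * (y \<lhd> w) \<and> (x \<lhd> w) * y = x * (w \<rhd> y))}"

definition mult_one :: "'a::cstar_algebra set \<Rightarrow> 'a multiplier"
  where "mult_one I = ((\<lambda>x. if x \<in> I then x else 0), (\<lambda>x. if x \<in> I then x else 0))"

definition mult_times :: "'a multiplier \<Rightarrow> 'a multiplier \<Rightarrow> 'a multiplier"
  where "mult_times v w = ((\<lambda>x. v \<rhd> (w \<rhd> x)), (\<lambda>x. (x \<lhd> v) \<lhd> w))"

definition mult_adj :: "'a::cstar_algebra multiplier \<Rightarrow> 'a multiplier"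
  where "mult_adj w = ((\<lambda>x. adj (adj x \<lhd> w)), (\<lambda>x. adj (w \<rhd> adj x)))"

definition unitary_multipliers :: "'a::cstar_algebra set \<Rightarrow> 'a multiplier set"
  where "unitary_multipliers I = {w \<in> multipliers I.
    mult_times w (mult_adj w) = mult_one I \<and> mult_times (mult_adj w) w = mult_one I}"

definition Ad :: "'a::cstar_algebra multiplier \<Rightarrow> 'a \<Rightarrow> 'a"
  where "Ad w x = (w \<rhd> x) \<lhd> mult_adj w"

text \<open>\<open>f on A\<close> as a partial map. Composing such maps with \<open>\<circ>\<^sub>m\<close> yields the composition
  on its natural domain, and equality includes equality of domains.\<close>

definition partial_map :: "'a set \<Rightarrow> ('a \<Rightarrow> 'b) \<Rightarrow> 'a \<rightharpoonup> 'b"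
  where "partial_map A f = (Some \<circ> f) |` A"

definition twisted_action ::
  "('s::inverse_semigroup \<Rightarrow> 'b::cstar_algebra set) \<Rightarrow> ('s \<Rightarrow> 'b \<Rightarrow> 'b) \<Rightarrow>
   ('s \<Rightarrow> 's \<Rightarrow> 'b multiplier) \<Rightarrow> bool"
  where "twisted_action D \<beta> \<omega> \<longleftrightarrow>
    (\<forall>s. closed_ideal (D s)) \<and>
    closure (complex_vector.span (\<Union>s. D s)) = UNIV \<and>
    (\<forall>s. star_isomorphism_on (D (sinv s)) (D s) (\<beta> s)) \<and>
    (\<forall>s t. \<omega> s t \<in> unitary_multipliers (D (s * t))) \<and>
    (\<forall>r s. partial_map (D (sinv r)) (\<beta> r) \<circ>\<^sub>m partial_map (D (sinv s)) (\<beta> s)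
       = partial_map (D (r * s)) (Ad (\<omega> r s)) \<circ>\<^sub>m partial_map (D (sinv (r * s))) (\<beta> (r * s))) \<and>
    (\<forall>r s t. \<forall>x \<in> D (sinv r) \<inter> D (s * t).
       \<beta> r (x \<lhd> \<omega> s t) \<lhd> \<omega> r (s * t) = \<beta> r x \<lhd> \<omega> r s \<lhd> \<omega> (r * s) t) \<and>
    (\<forall>e\<in>idempotents. \<forall>f\<in>idempotents. \<omega> e f = mult_one (D (e * f))) \<and>
    (\<forall>r. \<omega> r (sinv r * r) = mult_one (D r) \<and> \<omega> (r * sinv r) r = mult_one (D r)) \<and>
    (\<forall>s. \<forall>e\<in>idempotents. \<forall>x \<in> D (sinv s * e * s).
       \<omega> (sinv s) e \<rhd> \<omega> (sinv s * e) s \<rhd> x = \<omega> (sinv s) s \<rhd> x)"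

end

theory Submission
  imports Defs
begin

text \<open>Beyond the hypotheses, a twisted action requires the normalization of \<open>\<omega>\<close> at idempotents and
  at the pairs \<open>(r, r\<^sup>* r)\<close>, \<open>(r r\<^sup>*, r)\<close>, which is immediate as \<open>r\<^sup>* r\<close> and \<open>r r\<^sup>*\<close> are
  idempotents, and the compatibility \<open>\<omega>(s\<^sup>*, e) \<omega>(s\<^sup>* e, s) x = \<omega>(s\<^sup>*, s) x\<close> on the ideal of
  \<open>s\<^sup>* e s\<close>.

  For the latter put \<open>f = s\<^sup>* e s\<close>, an idempotent below \<open>s\<^sup>* s\<close>. Since \<open>\<omega>\<close> is trivial on idempotents,
  the composition law, including its statement about domains, forces \<open>\<beta>\<^sub>e\<close> to be the identity of
  \<open>D\<^sub>e\<close> (\<open>beta_idempotent\<close>), and gives \<open>D\<^sub>e\<^sub>f = D\<^sub>e \<inter> D\<^sub>f\<close> (\<open>ideal_mult_idempotents\<close>) and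
  \<open>D\<^sub>s = D\<^sub>s\<^sub>s\<^sub>*\<close> (\<open>ideal_range_projection\<close>). So the multiplier \<open>\<omega>(s\<^sup>*, e)\<close> is the unit of
  \<open>D\<^sub>f\<close>, and compatibility says that \<open>\<omega>(s\<^sup>*, s)\<close>, a unitary multiplier of the larger ideal \<open>D\<close> of
  \<open>s\<^sup>* s\<close>, restricts on \<open>D\<^sub>f\<close> to \<open>\<omega>(s\<^sup>* e, s)\<close>. The cocycle identity for the triple
  \<open>(f, s\<^sup>*, s)\<close> says exactly this for right multiplication, because \<open>f s\<^sup>* = s\<^sup>* e\<close> and all other
  factors are trivial, but only for those \<open>x\<close> in \<open>D\<^sub>f\<close> for which \<open>x \<omega>(s\<^sup>*, s)\<close> is known to stay in
  \<open>D\<^sub>f\<close>, such as products of two elements of \<open>D\<^sub>f\<close>. The passage from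
  products to all of \<open>D\<^sub>f\<close>, and from right to left multiplication, is usually made by an approximate
  unit; \<open>unitary_multiplier_restrict\<close> does it by the \<open>C\<^sup>*\<close>-identity and unitarity alone.\<close>

section \<open>Inverse semigroups\<close>

lemma sinv_inverse:
  fixes s :: "'s::inverse_semigroup"
  shows "s * sinv s * s = s" and "sinv s * s * sinv s = sinv s"
  using theI'[OF ex1_inverse[of s]] unfolding sinv_def by auto

lemma sinv_unique:
  fixes s :: "'s::inverse_semigroup"
  assumes "s * t * s = s" and "t * s * t = t"
  shows "sinv s = t"
  using ex1_inverse[of s] assms sinv_inverse[of s] by blast

lemma sinv_sinv: "sinv (sinv s) = (s::'s::inverse_semigroup)"
  by (rule sinv_unique) (rule sinv_inverse)+

lemma sinv_idempotent: "e \<in> idempotents \<Longrightarrow> sinv e = (e::'s::inverse_semigroup)"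
  by (rule sinv_unique) (simp_all add: idempotents_def)

lemma domain_projection_idempotent: "sinv s * s \<in> (idempotents::'s::inverse_semigroup set)"
  and range_projection_idempotent: "s * sinv s \<in> (idempotents::'s::inverse_semigroup set)"
  using sinv_inverse[of s] by (simp_all add: idempotents_def mult.assoc[symmetric])

text \<open>If \<open>x\<close> is the inverse of \<open>e f\<close>, then so is \<open>f x e\<close>, which is idempotent; hence \<open>x\<close> is
  idempotent, and then \<open>e f\<close>, its inverse, equals \<open>x\<close>.\<close>

lemma idempotents_mult_closed:
  fixes e f :: "'s::inverse_semigroup"
  assumes e: "e \<in> idempotents" and f: "f \<in> idempotents"
  shows "e * f \<in> idempotents"
proof -
  have ee: "e * e = e" and ff: "f * f = f"
    and ee': "e * (e * y) = e * y" and ff': "f * (f * y) = f * y" for y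
    using e f by (simp_all add: idempotents_def mult.assoc[symmetric])
  define x where "x = sinv (e * f)"
  have x: "e * (f * (x * (e * f))) = e * f" "x * (e * (f * x)) = x"
    using sinv_inverse[of "e * f"] by (simp_all add: x_def mult.assoc)
  have xx: "x * (e * (f * (x * y))) = x * y" for y
    using arg_cong[OF x(2), of "\<lambda>z. z * y"] by (simp add: mult.assoc)
  have fxe: "x = f * x * e"
    unfolding x_def
    by (rule sinv_unique) (simp_all add: mult.assoc ee' ff' x xx flip: x_def)
  have "x * x = f * (x * (e * (f * x))) * e"
    by (subst fxe, subst (2) fxe) (simp only: mult.assoc)
  then have "x * x = x"
    using fxe by (simp add: x)
  then have "x \<in> idempotents"
    by (simp add: idempotents_def)
  then show ?thesis
    using sinv_idempotent[of x] sinv_sinv[of "e * f"] by (simp add: x_def)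
qed

text \<open>Both \<open>e f\<close> and \<open>f e\<close> are inverses of \<open>e f\<close>.\<close>

lemma idempotents_commute:
  fixes e f :: "'s::inverse_semigroup"
  assumes e: "e \<in> idempotents" and f: "f \<in> idempotents"
  shows "e * f = f * e"
proof -
  have ee: "e * (e * y) = e * y" and ff: "f * (f * y) = f * y" for y
    using e f by (simp_all add: idempotents_def mult.assoc[symmetric])
  have ef: "e * (f * (e * f)) = e * f" and fe: "f * (e * (f * e)) = f * e"
    using idempotents_mult_closed[OF e f] idempotents_mult_closed[OF f e]
    by (simp_all add: idempotents_def mult.assoc)
  have "sinv (e * f) = f * e"
    by (rule sinv_unique) (simp_all add: mult.assoc ee ff ef fe)
  then show ?thesis
    using sinv_idempotent[OF idempotents_mult_closed[OF e f]] by simp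
qed

lemma sinv_mult_idempotent:
  fixes s :: "'s::inverse_semigroup"
  assumes e: "e \<in> idempotents"
  shows "sinv (sinv s * e) = e * s"
proof (rule sinv_unique)
  have ee: "e * e = e"
    using e by (simp add: idempotents_def)
  have comm: "e * (s * sinv s) = s * sinv s * e"
    using idempotents_commute[OF e range_projection_idempotent] .
  have "sinv s * e * (e * s) * (sinv s * e) = sinv s * (e * e) * (s * sinv s) * e"
    by (simp only: mult.assoc)
  also have "\<dots> = sinv s * (e * (s * sinv s)) * e"
    by (simp only: ee mult.assoc)
  also have "\<dots> = (sinv s * s * sinv s) * (e * e)"
    by (simp only: comm mult.assoc)
  finally show "sinv s * e * (e * s) * (sinv s * e) = sinv s * e"
    by (simp add: ee sinv_inverse)
  have "e * s * (sinv s * e) * (e * s) = (e * (s * sinv s)) * (e * e) * s"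
    by (simp only: mult.assoc)
  also have "\<dots> = (s * sinv s * e) * e * s"
    by (simp only: ee comm)
  also have "\<dots> = (e * (s * sinv s)) * s"
    by (simp only: comm) (simp only: ee mult.assoc)
  finally show "e * s * (sinv s * e) * (e * s) = e * s"
    by (simp add: mult.assoc) (simp add: mult.assoc[symmetric] sinv_inverse)
qed

section \<open>Unitary multipliers of ideals\<close>

lemma adj_diff: "adj (x - y) = adj x - adj (y::'a::cstar_algebra)"
  using adj_add[of "x - y" y] by (simp add: algebra_simps)

lemma adj_zero: "adj (0::'a::cstar_algebra) = 0"
  using adj_diff[of 0 "0::'a"] by simp

lemma adj_mult_self_eq_zero: "adj x * x = 0 \<Longrightarrow> x = (0::'a::cstar_algebra)"
  using cstar_identity[of x] by simp

lemma closed_ideal_mult_right: "closed_ideal I \<Longrightarrow> x \<in> I \<Longrightarrow> x * b \<in> I"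
  by (simp add: closed_ideal_def)

lemma closed_ideal_zero: "closed_ideal I \<Longrightarrow> 0 \<in> I"
  by (simp add: closed_ideal_def complex_vector.subspace_0)

lemma mult_one_left: "x \<in> I \<Longrightarrow> mult_one I \<rhd> x = x"
  and mult_one_right: "x \<in> I \<Longrightarrow> x \<lhd> mult_one I = x"
  by (simp_all add: mult_one_def lmult_def rmult_def)

lemma multiplier_closed:
  "w \<in> multipliers I \<Longrightarrow> x \<in> I \<Longrightarrow> w \<rhd> x \<in> I"
  "w \<in> multipliers I \<Longrightarrow> x \<in> I \<Longrightarrow> x \<lhd> w \<in> I"
  by (simp_all add: multipliers_def)

lemma multiplier_balanced:
  "w \<in> multipliers I \<Longrightarrow> x \<in> I \<Longrightarrow> y \<in> I \<Longrightarrow> (x \<lhd> w) * y = x * (w \<rhd> y)"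
  by (simp add: multipliers_def)

lemma unitary_multiplier_is_multiplier:
  "w \<in> unitary_multipliers I \<Longrightarrow> w \<in> multipliers I"
  by (simp add: unitary_multipliers_def)

lemma unitary_multiplier_cancel:
  assumes "w \<in> unitary_multipliers I" and "x \<in> I"
  shows "w \<rhd> adj (adj x \<lhd> w) = x" and "adj (adj (w \<rhd> x) \<lhd> w) = x"
proof -
  have "fst (mult_times w (mult_adj w)) x = x" "fst (mult_times (mult_adj w) w) x = x"
    using assms by (simp_all add: unitary_multipliers_def mult_one_def)
  then show "w \<rhd> adj (adj x \<lhd> w) = x" and "adj (adj (w \<rhd> x) \<lhd> w) = x"
    by (simp_all add: mult_times_def mult_adj_def lmult_def)
qed

text \<open>Closed ideals of \<open>C\<^sup>*\<close>-algebras are self-adjoint in any case, but a unitary multiplier \<open>w\<close>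
  makes this immediate: as \<open>w\<close> vanishes off \<open>I\<close>, an \<open>x\<close> in \<open>I\<close> with \<open>x\<^sup>*\<close> outside \<open>I\<close> would
  satisfy \<open>x = w (x\<^sup>* w)\<^sup>* = 0\<close>.\<close>

lemma unitary_multiplier_imp_adj_closed:
  assumes I: "closed_ideal I" and w: "w \<in> unitary_multipliers I" and x: "x \<in> I"
  shows "adj x \<in> I"
proof (rule ccontr)
  assume out: "adj x \<notin> I"
  have mult: "w \<in> multipliers I"
    using w by (rule unitary_multiplier_is_multiplier)
  have "adj x \<lhd> w = 0"
    using mult out by (simp add: multipliers_def)
  then have "x = w \<rhd> 0"
    using unitary_multiplier_cancel(1)[OF w x] by (simp add: adj_zero)
  moreover have "w \<rhd> (0 * 0) = (w \<rhd> 0) * 0"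
    using mult closed_ideal_zero[OF I] unfolding multipliers_def by blast
  ultimately have "x = 0"
    by simp
  then show False
    using out closed_ideal_zero[OF I] by (simp add: adj_zero)
qed

lemma unitary_multiplier_isometric:
  assumes I: "closed_ideal I" and w: "w \<in> unitary_multipliers I" and x: "x \<in> I"
  shows "adj (w \<rhd> x) * (w \<rhd> x) = adj x * x"
proof -
  have mult: "w \<in> multipliers I"
    using w by (rule unitary_multiplier_is_multiplier)
  have "adj (w \<rhd> x) \<in> I"
    using unitary_multiplier_imp_adj_closed[OF I w] multiplier_closed(1)[OF mult x] by blast
  then have "adj (w \<rhd> x) * (w \<rhd> x) = (adj (w \<rhd> x) \<lhd> w) * x"
    using multiplier_balanced[OF mult] x by simp
  also have "adj (w \<rhd> x) \<lhd> w = adj x"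
    using unitary_multiplier_cancel(2)[OF w x] by (metis adj_adj)
  finally show ?thesis .
qed

text \<open>Let \<open>u = w x - v x\<close>. Agreement on products gives \<open>a b u = 0\<close> for all \<open>a\<close>, \<open>b\<close> in \<open>I\<close>, hence
  \<open>b u = 0\<close> by taking \<open>a = (b u)\<^sup>*\<close>. As \<open>v x\<close> lies in \<open>I\<close>, it is therefore orthogonal to \<open>u\<close>, so
  \<open>(w x)\<^sup>* (w x) = u\<^sup>* u + (v x)\<^sup>* (v x)\<close>; both squares equal \<open>x\<^sup>* x\<close> by unitarity, and \<open>u = 0\<close>.\<close>

lemma unitary_multiplier_restrict:
  assumes I: "closed_ideal I" and J: "closed_ideal J" and sub: "I \<subseteq> J"
    and v: "v \<in> unitary_multipliers I" and w: "w \<in> unitary_multipliers J"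
    and agree: "\<And>a b. a \<in> I \<Longrightarrow> b \<in> I \<Longrightarrow> (a * b) \<lhd> w = (a * b) \<lhd> v"
    and x: "x \<in> I"
  shows "w \<rhd> x = v \<rhd> x"
proof -
  note vm = unitary_multiplier_is_multiplier[OF v]
  note wm = unitary_multiplier_is_multiplier[OF w]
  note adj_closed = unitary_multiplier_imp_adj_closed[OF I v]
  define u where "u = w \<rhd> x - v \<rhd> x"
  have kill2: "a * (b * u) = 0" if a: "a \<in> I" and b: "b \<in> I" for a b
  proof -
    have ab: "a * b \<in> I"
      using closed_ideal_mult_right[OF I a] .
    have "(a * b) * (w \<rhd> x) = (a * b) * (v \<rhd> x)"
      using multiplier_balanced[OF wm, of "a * b" x] multiplier_balanced[OF vm ab x]
        agree[OF a b] subsetD[OF sub ab] subsetD[OF sub x] by simp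
    then show ?thesis
      by (simp add: u_def right_diff_distrib flip: mult.assoc)
  qed
  have kill: "b * u = 0" if b: "b \<in> I" for b
  proof -
    have "adj (b * u) \<in> I"
      using adj_closed closed_ideal_mult_right[OF I b] by blast
    then show ?thesis
      using kill2[OF _ b] adj_mult_self_eq_zero by blast
  qed
  define z where "z = v \<rhd> x"
  have "z \<in> I"
    using multiplier_closed(1)[OF vm x] by (simp add: z_def)
  then have zu: "adj z * u = 0"
    using kill adj_closed by blast
  have uz: "adj u * z = 0"
    using arg_cong[OF zu, of adj] by (simp add: adj_mult adj_adj adj_zero)
  have "w \<rhd> x = u + z"
    by (simp add: u_def z_def)
  then have "adj u * u + adj z * z = adj (w \<rhd> x) * (w \<rhd> x)"
    by (simp add: adj_add algebra_simps zu uz)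
  also have "\<dots> = adj z * z"
    unfolding z_def
    using unitary_multiplier_isometric[OF J w, of x] unitary_multiplier_isometric[OF I v x] x sub
    by auto
  finally have "adj u * u = 0"
    by simp
  then have "u = 0"
    by (rule adj_mult_self_eq_zero)
  then show ?thesis
    by (simp add: u_def)
qed

lemma Ad_mult_one:
  assumes "\<And>x. x \<in> I \<Longrightarrow> adj x \<in> I" and "x \<in> I"
  shows "Ad (mult_one I) x = x"
  using assms by (simp add: Ad_def mult_adj_def mult_one_def lmult_def rmult_def adj_adj)

section \<open>The ideals of a normalized twist\<close>

lemma star_isomorphism_on_mem: "star_isomorphism_on I J f \<Longrightarrow> x \<in> I \<Longrightarrow> f x \<in> J"
  unfolding star_isomorphism_on_def by (auto dest: bij_betwE)

lemma partial_map_comp_eq_iff: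
  "(partial_map A f \<circ>\<^sub>m partial_map B g) x = Some y \<longleftrightarrow> x \<in> B \<and> g x \<in> A \<and> f (g x) = y"
  by (auto simp: partial_map_def map_comp_def restrict_map_def split: option.splits if_splits)

locale normalized_twist =
  fixes D :: "'s::inverse_semigroup \<Rightarrow> 'b::cstar_algebra set"
    and \<beta> :: "'s \<Rightarrow> 'b \<Rightarrow> 'b"
    and \<omega> :: "'s \<Rightarrow> 's \<Rightarrow> 'b multiplier"
  assumes ideals: "closed_ideal (D s)"
    and isos: "star_isomorphism_on (D (sinv s)) (D s) (\<beta> s)"
    and unitaries: "\<omega> s t \<in> unitary_multipliers (D (s * t))"
    and composition:
      "partial_map (D (sinv r)) (\<beta> r) \<circ>\<^sub>m partial_map (D (sinv s)) (\<beta> s)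
        = partial_map (D (r * s)) (Ad (\<omega> r s)) \<circ>\<^sub>m partial_map (D (sinv (r * s))) (\<beta> (r * s))"
    and cocycle: "x \<in> D (sinv r) \<inter> D (s * t) \<Longrightarrow>
      \<beta> r (x \<lhd> \<omega> s t) \<lhd> \<omega> r (s * t) = \<beta> r x \<lhd> \<omega> r s \<lhd> \<omega> (r * s) t"
    and unit_right: "e \<in> idempotents \<Longrightarrow> \<omega> s e = mult_one (D (s * e))"
    and unit_left: "e \<in> idempotents \<Longrightarrow> \<omega> e s = mult_one (D (e * s))"
begin

lemma composition_domain:
  "x \<in> D (sinv (r * s)) \<longleftrightarrow> x \<in> D (sinv s) \<and> \<beta> s x \<in> D (sinv r)"
  using partial_map_comp_eq_iff[of "D (sinv r)" "\<beta> r" "D (sinv s)" "\<beta> s" x]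
    partial_map_comp_eq_iff[of "D (r * s)" "Ad (\<omega> r s)" "D (sinv (r * s))" "\<beta> (r * s)" x]
    star_isomorphism_on_mem[OF isos, of x "r * s"]
  unfolding composition by blast

lemma composition_value:
  "x \<in> D (sinv (r * s)) \<Longrightarrow> \<beta> r (\<beta> s x) = Ad (\<omega> r s) (\<beta> (r * s) x)"
  using partial_map_comp_eq_iff[of "D (sinv r)" "\<beta> r" "D (sinv s)" "\<beta> s" x]
    partial_map_comp_eq_iff[of "D (r * s)" "Ad (\<omega> r s)" "D (sinv (r * s))" "\<beta> (r * s)" x]
    star_isomorphism_on_mem[OF isos, of x "r * s"]
  unfolding composition by blast

lemma adj_closed_idempotent: "e \<in> idempotents \<Longrightarrow> x \<in> D e \<Longrightarrow> adj x \<in> D e"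
  using unitary_multiplier_imp_adj_closed[OF ideals, of "\<omega> e e" e x] unitaries[of e e]
  by (simp add: idempotents_def)

text \<open>Triviality of \<open>\<omega>(e, e)\<close> makes \<open>\<beta>\<^sub>e\<close> an idempotent map, and it is injective.\<close>

lemma beta_idempotent:
  assumes e: "e \<in> idempotents" and x: "x \<in> D e"
  shows "\<beta> e x = x"
proof -
  have ee: "e * e = e" and inv: "sinv e = e"
    using e sinv_idempotent by (auto simp: idempotents_def)
  have bx: "\<beta> e x \<in> D e"
    using star_isomorphism_on_mem[OF isos[of e]] x by (simp add: inv)
  have "\<beta> e (\<beta> e x) = Ad (mult_one (D e)) (\<beta> e x)"
    using composition_value[of x e e] unit_left[OF e, of e] x by (simp add: ee inv)
  also have "\<dots> = \<beta> e x"
    using Ad_mult_one[OF adj_closed_idempotent[OF e] bx] .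
  finally have "\<beta> e (\<beta> e x) = \<beta> e x" .
  moreover have "inj_on (\<beta> e) (D e)"
    using isos[of e] by (simp add: inv star_isomorphism_on_def bij_betw_def)
  ultimately show ?thesis
    using bx x by (simp add: inj_on_eq_iff)
qed

lemma ideal_mult_idempotents:
  assumes e: "e \<in> idempotents" and f: "f \<in> idempotents"
  shows "D (e * f) = D e \<inter> D f"
  using composition_domain[of _ e f] beta_idempotent[OF f]
    sinv_idempotent[OF e] sinv_idempotent[OF f] sinv_idempotent[OF idempotents_mult_closed[OF e f]]
  by auto

text \<open>The domain of \<open>\<beta>\<^sub>s \<circ> \<beta>\<^sub>s\<^sub>*\<close> is all of \<open>D\<^sub>s\<close>, whereas the composition law gives it as that of
  the map indexed by \<open>s s\<^sup>*\<close>.\<close>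

lemma ideal_range_projection: "D (s * sinv s) = D s"
  using composition_domain[of _ s "sinv s"] star_isomorphism_on_mem[OF isos[of "sinv s"]]
    sinv_idempotent[OF range_projection_idempotent[of s]]
  by (auto simp: sinv_sinv)

text \<open>The cocycle identity for \<open>(f, s\<^sup>*, s)\<close>, where \<open>f = s\<^sup>* e s\<close>, compares the two multipliers on
  products of elements of \<open>D\<^sub>f\<close>; there \<open>\<beta>\<^sub>f\<close> is the identity, and all twists in it but the two to
  be compared have an idempotent argument.\<close>

lemma twist_compatible:
  assumes e: "e \<in> idempotents" and x: "x \<in> D (sinv s * e * s)"
  shows "\<omega> (sinv s) e \<rhd> \<omega> (sinv s * e) s \<rhd> x = \<omega> (sinv s) s \<rhd> x"
proof -
  define f where "f = sinv s * e * s"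
  have "sinv s * e * sinv (sinv s * e) = sinv s * (e * e) * s"
    by (simp only: sinv_mult_idempotent[OF e] mult.assoc)
  then have range_proj: "sinv s * e * sinv (sinv s * e) = f"
    using e by (simp add: f_def idempotents_def)
  have f: "f \<in> idempotents"
    using range_projection_idempotent[of "sinv s * e"] by (simp only: range_proj)
  have Df: "D (sinv s * e) = D f"
    using ideal_range_projection[of "sinv s * e"] by (simp only: range_proj)
  have "f * sinv s = sinv s * (e * (s * sinv s))"
    by (simp only: f_def mult.assoc)
  also have "\<dots> = (sinv s * s * sinv s) * e"
    by (simp only: idempotents_commute[OF e range_projection_idempotent] mult.assoc)
  finally have fs: "f * sinv s = sinv s * e"
    by (simp only: sinv_inverse)
  have "f * (sinv s * s) = sinv s * e * (s * sinv s * s)"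
    by (simp only: f_def mult.assoc)
  then have fss: "f * (sinv s * s) = f"
    by (simp only: sinv_inverse f_def)
  have sub: "D f \<subseteq> D (sinv s * s)"
    using ideal_mult_idempotents[OF f domain_projection_idempotent[of s]] by (auto simp: fss)
  have wf: "\<omega> (sinv s * e) s \<in> unitary_multipliers (D f)"
    using unitaries[of "sinv s * e" s] by (simp only: f_def)
  have agree: "(a * b) \<lhd> \<omega> (sinv s) s = (a * b) \<lhd> \<omega> (sinv s * e) s"
    if a: "a \<in> D f" and b: "b \<in> D f" for a b
  proof -
    have ab: "a * b \<in> D f"
      using closed_ideal_mult_right[OF ideals a] .
    \<comment> \<open>For a product, the multiplier of the larger ideal visibly stays in \<open>D f\<close>, so \<open>\<beta> f\<close> fixes the
      value.\<close>
    have "(a * b) \<lhd> \<omega> (sinv s) s = a * (b \<lhd> \<omega> (sinv s) s)"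
      using unitary_multiplier_is_multiplier[OF unitaries[of "sinv s" s]]
        subsetD[OF sub a] subsetD[OF sub b]
      unfolding multipliers_def by blast
    then have mem: "(a * b) \<lhd> \<omega> (sinv s) s \<in> D f"
      using closed_ideal_mult_right[OF ideals a] by simp
    have "\<beta> f ((a * b) \<lhd> \<omega> (sinv s) s) \<lhd> \<omega> f (sinv s * s)
        = \<beta> f (a * b) \<lhd> \<omega> f (sinv s) \<lhd> \<omega> (f * sinv s) s"
      using cocycle[of "a * b" f "sinv s" s] ab sub sinv_idempotent[OF f] by auto
    then show ?thesis
      using mem ab
      by (simp add: beta_idempotent[OF f] unit_left[OF f] fs fss Df mult_one_right)
  qed
  have eq: "\<omega> (sinv s) s \<rhd> x = \<omega> (sinv s * e) s \<rhd> x"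
    using unitary_multiplier_restrict[OF ideals ideals sub wf unitaries agree] x
    by (simp add: f_def)
  have "\<omega> (sinv s * e) s \<rhd> x \<in> D f"
    using multiplier_closed(1)[OF unitary_multiplier_is_multiplier[OF wf]] x by (simp add: f_def)
  then show ?thesis
    by (simp add: eq unit_right[OF e] Df mult_one_left)
qed

end

section \<open>Normalized twists are twisted actions\<close>

theorem proposition5p1:
  fixes D :: "'s::inverse_semigroup \<Rightarrow> 'b::cstar_algebra set"
    and \<beta> :: "'s \<Rightarrow> 'b \<Rightarrow> 'b"
    and \<omega> :: "'s \<Rightarrow> 's \<Rightarrow> 'b multiplier"
  assumes ideals: "\<And>s. closed_ideal (D s)"
    and dense: "closure (complex_vector.span (\<Union>s. D s)) = UNIV"
    and isos: "\<And>s. star_isomorphism_on (D (sinv s)) (D s) (\<beta> s)"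
    and unitaries: "\<And>s t. \<omega> s t \<in> unitary_multipliers (D (s * t))"
    and composition: "\<And>r s.
      partial_map (D (sinv r)) (\<beta> r) \<circ>\<^sub>m partial_map (D (sinv s)) (\<beta> s)
        = partial_map (D (r * s)) (Ad (\<omega> r s)) \<circ>\<^sub>m partial_map (D (sinv (r * s))) (\<beta> (r * s))"
    and cocycle: "\<And>r s t x. x \<in> D (sinv r) \<inter> D (s * t) \<Longrightarrow>
      \<beta> r (x \<lhd> \<omega> s t) \<lhd> \<omega> r (s * t) = \<beta> r x \<lhd> \<omega> r s \<lhd> \<omega> (r * s) t"
    and unit_right: "\<And>s e. e \<in> idempotents \<Longrightarrow> \<omega> s e = mult_one (D (s * e))"
    and unit_left: "\<And>s e. e \<in> idempotents \<Longrightarrow> \<omega> e s = mult_one (D (e * s))"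
  shows "twisted_action D \<beta> \<omega>"
proof -
  interpret normalized_twist D \<beta> \<omega>
    by unfold_locales
      (fact ideals isos unitaries composition unit_right unit_left | rule cocycle, assumption)+
  have one: "\<omega> r (sinv r * r) = mult_one (D r)" "\<omega> (r * sinv r) r = mult_one (D r)" for r
    using unit_right[OF domain_projection_idempotent, of r r]
      unit_left[OF range_projection_idempotent, of r r] sinv_inverse(1)[of r]
    by (simp_all add: mult.assoc)
  show ?thesis
    unfolding twisted_action_def
    by (intro conjI allI ballI)
      (fact ideals dense isos unitaries composition one |
        rule unit_left cocycle twist_compatible, assumption+)+
qed

end
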